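(* Let $F$ be a probability distribution with support on the non-negative integers, and let $\Psi$ be a random arrow configuration on $\mathbb{Z}$ generated by the RD-algorithm with degree distribution $F$. If $F$ has finite mean, then, for all stationary pairing rules $\mathcal{A}$ for $\Psi$, the total length $T_{\mathcal{A}}$ of all edges connected to the origin satisfies $\mathrm{E}[T_{\mathcal{A}}]=\infty$. If, in addition, $F$ has bounded support, then, for all stationary pairing rules $\mathcal{A}$, the length $N_{\mathcal{A}}$ of the longest edge connected to the origin satisfies $\mathrm{E}[N_{\mathcal{A}}]=\infty$.
   Context: RD-algorithm with degree distribution $F$: to each vertex $i\in\mathbb{Z}$ attach $D_i$ stubs, where $(D_i)_{i\in\mathbb{Z}}$ are i.i.d. with distribution $F$; independently of everything else, each stub is turned into a right-arrow with probability $1/2$ and into a left-arrow with probability $1/2$. The result is the arrow configuration $\Psi$. A pairing rule $\mathcal{A}$ is an algorithm for connecting the arrows of $\Psi$ into edges such that, with probability $1$, each left-arrow is connected to exactly one right-arrow and each right-arrow is connected to exactly one left-arrow; connected arrows point towards each other, i.e. a right-arrow at vertex $i$ is connected to a left-arrow at some vertex $i'>i$, which gives an edge between $i$ and $i'$ of length $i'-i$. The rule $\mathcal{A}$ is stationary if the resulting joint edge length distributions are translation invariant. $T_{\mathcal{A}}$ is the total length of all edges connected to the origin, and $N_{\mathcal{A}}$ is the length of the longest edge connected to the origin.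
   Formalization: The degree distribution F is additionally assumed not to be the point mass at 0; for that F there are no edges, so E[T] = E[N] = 0 and the claim fails. *)

theory Defs
  imports "HOL-Probability.Probability"
begin

text \<open>The stub \<open>(i, j)\<close> is the \<open>j\<close>-th stub at vertex \<open>i\<close>; stubs are counted from \<open>0\<close>.\<close>

type_synonym stub = "int \<times> nat"

text \<open>
  The edge \<open>(a, b)\<close> connects the right-arrow \<open>a\<close> to the left-arrow \<open>b\<close>. Edges are pairs of
  stubs rather than pairs of vertices, since multiple edges between two vertices are allowed.
\<close>

type_synonym edge = "stub \<times> stub"

text \<open>
  A coin \<open>right (i, j)\<close> is tossed for every \<open>j\<close>, but only the coins with \<open>j < D i\<close> belong to a
  stub. The probability space may carry further randomness, on which a pairing rule may depend.
\<close>

locale rd_algorithm = prob_space M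
  for M :: "'w measure" +
  fixes F :: "nat pmf"
    and D :: "int \<Rightarrow> 'w \<Rightarrow> nat"
    and right :: "stub \<Rightarrow> 'w \<Rightarrow> bool"
  assumes indep_D: "indep_vars (\<lambda>_. count_space UNIV) D UNIV"
    and distr_D: "\<And>i. distr M (count_space UNIV) (D i) = measure_pmf F"
    and indep_right: "indep_vars (\<lambda>_. count_space UNIV) right UNIV"
    and distr_right:
      "\<And>s. distr M (count_space UNIV) (right s) = measure_pmf (bernoulli_pmf (1 / 2))"
    and indep_D_right:
      "indep_set
         (sets (vimage_algebra (space M) (\<lambda>\<omega> i. D i \<omega>) (Pi\<^sub>M UNIV (\<lambda>_. count_space UNIV))))
         (sets (vimage_algebra (space M) (\<lambda>\<omega> s. right s \<omega>) (Pi\<^sub>M UNIV (\<lambda>_. count_space UNIV))))"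

definition right_arrows ::
  "(int \<Rightarrow> 'w \<Rightarrow> nat) \<Rightarrow> (stub \<Rightarrow> 'w \<Rightarrow> bool) \<Rightarrow> 'w \<Rightarrow> stub set" where
  "right_arrows D right \<omega> = {(i, j). j < D i \<omega> \<and> right (i, j) \<omega>}"

definition left_arrows ::
  "(int \<Rightarrow> 'w \<Rightarrow> nat) \<Rightarrow> (stub \<Rightarrow> 'w \<Rightarrow> bool) \<Rightarrow> 'w \<Rightarrow> stub set" where
  "left_arrows D right \<omega> = {(i, j). j < D i \<omega> \<and> \<not> right (i, j) \<omega>}"

definition perfect_pairing :: "stub set \<Rightarrow> stub set \<Rightarrow> edge set \<Rightarrow> bool" where
  "perfect_pairing R L G \<longleftrightarrow>
     (\<forall>(a, b) \<in> G. a \<in> R \<and> b \<in> L \<and> fst a < fst b) \<and>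
     (\<forall>a \<in> R. \<exists>!b. (a, b) \<in> G) \<and>
     (\<forall>b \<in> L. \<exists>!a. (a, b) \<in> G)"

definition edges_at :: "edge set \<Rightarrow> int \<Rightarrow> edge set" where
  "edges_at G i = {(a, b) \<in> G. fst a = i \<or> fst b = i}"

definition edge_length :: "edge \<Rightarrow> nat" where
  "edge_length e = nat (fst (snd e) - fst (fst e))"

definition pairing_rule ::
  "'w measure \<Rightarrow> (int \<Rightarrow> 'w \<Rightarrow> nat) \<Rightarrow> (stub \<Rightarrow> 'w \<Rightarrow> bool) \<Rightarrow> ('w \<Rightarrow> edge set) \<Rightarrow> bool" where
  "pairing_rule M D right A \<longleftrightarrow>
     (\<forall>e. {\<omega> \<in> space M. e \<in> A \<omega>} \<in> sets M) \<and>
     (AE \<omega> in M. perfect_pairing (right_arrows D right \<omega>) (left_arrows D right \<omega>) (A \<omega>))"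

text \<open>
  The edge lengths at a vertex \<open>i\<close> form a multiset, given by the number of edges at \<open>i\<close> of each
  length, so that stationarity does not depend on how the stubs at a vertex are numbered.
\<close>

definition edge_length_count :: "edge set \<Rightarrow> int \<Rightarrow> nat \<Rightarrow> nat" where
  "edge_length_count G i l = card {e \<in> edges_at G i. edge_length e = l}"

definition stationary_rule :: "'w measure \<Rightarrow> ('w \<Rightarrow> edge set) \<Rightarrow> bool" where
  "stationary_rule M A \<longleftrightarrow>
     (\<forall>k. distr M (Pi\<^sub>M UNIV (\<lambda>_. count_space UNIV))
                  (\<lambda>\<omega> (i, l). edge_length_count (A \<omega>) (i + k) l)
        = distr M (Pi\<^sub>M UNIV (\<lambda>_. count_space UNIV))
                  (\<lambda>\<omega> (i, l). edge_length_count (A \<omega>) i l))"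

definition total_length :: "edge set \<Rightarrow> int \<Rightarrow> ennreal" where
  "total_length G i = (\<Sum>\<^sub>\<infinity>e\<in>edges_at G i. of_nat (edge_length e))"

text \<open>At a vertex without edges the supremum, taken in \<^typ>\<open>ennreal\<close>, is \<open>0\<close>.\<close>

definition longest_length :: "edge set \<Rightarrow> int \<Rightarrow> ennreal" where
  "longest_length G i = (SUP e\<in>edges_at G i. of_nat (edge_length e))"

end

theory Submission
  imports Defs
begin

text \<open>
  The imbalance \<open>S\<^sub>n\<close> between right- and left-arrows on \<open>{1..n}\<close> is at most the number of edges with
  exactly one end in \<open>{1..n}\<close>. By stationarity the expected number of these is at most
  \<open>2 \<Sum>\<^sub>k E[number of edges of length \<ge> k at 0] = 2 E[T]\<close>. So if \<open>E[T]\<close> were finite, \<open>E\<bar>S\<^sub>n\<bar>\<close> would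
  stay bounded, and \<open>E[cos (t S\<^sub>n)] \<ge> 1 - t E\<bar>S\<^sub>n\<bar> \<ge> 1/2\<close> for some small \<open>t > 0\<close> and all \<open>n\<close>. But \<open>S\<^sub>n\<close> is
  a sum of \<open>n\<close> independent copies of a variable with characteristic function \<open>E[(cos t)\<^sup>D]\<close>, so
  \<open>E[cos (t S\<^sub>n)] = E[(cos t)\<^sup>D]^n\<close>, which tends to \<open>0\<close> since \<open>D\<close> is not almost surely \<open>0\<close>. When \<open>D \<le> K\<close>,
  there are at most \<open>K\<close> edges at the origin, so that \<open>T \<le> K N\<close>.
\<close>

section \<open>Deterministic counting of signs, arrows and edges\<close>

lemma sum_signs:
  assumes "finite W"
  shows "(\<Sum>s\<in>W. if P s then 1 else -1 :: real) = real (card {s \<in> W. P s}) - real (card {s \<in> W. \<not> P s})"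
proof -
  have "(\<Sum>s\<in>W. if P s then 1 else -1 :: real) = (\<Sum>s\<in>W. (if P s then 1 else 0) - (if \<not> P s then 1 else 0))"
    by (rule sum.cong) auto
  also have "\<dots> = real (card {s \<in> W. P s}) - real (card {s \<in> W. \<not> P s})"
    using assms by (simp add: sum_subtractf sum.If_cases Int_def flip: sum.inter_filter)
  finally show ?thesis .
qed

text \<open>Send each edge at \<open>i\<close> to its end at \<open>i\<close>, which is unique
  because the two ends lie at different vertices. Since no stub is both a right- and a left-arrow, a
  stub belongs to only one edge, so this map \<open>f\<close> is injective.\<close>

lemma perfect_pairing_finite_edges_at:
  assumes pp: "perfect_pairing R L G" and disj: "R \<inter> L = {}"
    and fin: "finite {s \<in> R \<union> L. fst s = i}"
  shows "finite (edges_at G i)" "card (edges_at G i) \<le> card {s \<in> R \<union> L. fst s = i}"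
proof -
  define f where "f = (\<lambda>e :: edge. if fst (fst e) = i then fst e else snd e)"
  have *: "a \<in> R \<and> b \<in> L \<and> fst a < fst b" if "(a, b) \<in> G" for a b
    using pp that by (auto simp: perfect_pairing_def)
  have inj1: "b = b'" if "(a, b) \<in> G" "(a, b') \<in> G" for a b b'
    using pp that *[of a b] unfolding perfect_pairing_def by blast
  have inj2: "a = a'" if "(a, b) \<in> G" "(a', b) \<in> G" for a a' b
    using pp that *[of a b] unfolding perfect_pairing_def by blast
  have "inj_on f (edges_at G i)"
  proof (rule inj_onI)
    fix e e' assume H: "e \<in> edges_at G i" "e' \<in> edges_at G i" "f e = f e'"
    obtain a b a' b' where e: "e = (a, b)" "e' = (a', b')" by (cases e, cases e')
    have G: "(a, b) \<in> G" "(a', b') \<in> G"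
      using H e by (auto simp: edges_at_def)
    show "e = e'"
      using H(3) e *[OF G(1)] *[OF G(2)] G disj inj1 inj2
      by (auto simp: f_def split: if_splits)
  qed
  moreover have "f ` edges_at G i \<subseteq> {s \<in> R \<union> L. fst s = i}"
    using * by (auto simp: f_def edges_at_def)
  ultimately show "finite (edges_at G i)" "card (edges_at G i) \<le> card {s \<in> R \<union> L. fst s = i}"
    using fin by (auto intro: inj_on_finite card_inj_on_le)
qed

text \<open>Tail counts: summed over \<open>k\<close> from 1 on, they recover the total length at
  \<open>i\<close>.\<close>

definition long_edges :: "edge set \<Rightarrow> int \<Rightarrow> nat \<Rightarrow> edge set" where
  "long_edges G i k = {e \<in> edges_at G i. k \<le> edge_length e}"

text \<open>Edges with both ends in the window cancel; an edge leaving it is at least as long as the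
  distance from its inner end to the boundary.\<close>

lemma perfect_pairing_imbalance_le:
  assumes pp: "perfect_pairing R L G"
    and finR: "finite {s \<in> R. fst s \<in> {1..int n}}" and finL: "finite {s \<in> L. fst s \<in> {1..int n}}"
    and fin: "\<And>i. finite (edges_at G i)"
  shows "\<bar>real (card {s \<in> R. fst s \<in> {1..int n}}) - real (card {s \<in> L. fst s \<in> {1..int n}})\<bar>
    \<le> real (\<Sum>k=1..n. card (long_edges G (int n + 1 - int k) k) + card (long_edges G (int k) k))"
proof -
  \<comment> \<open>Edges that start, respectively end, in the window. \<open>fst\<close> and
    \<open>snd\<close> match them bijectively with the right- and left-arrows there, so the
    imbalance is \<open>card E1 - card E2\<close>.\<close>
  define E1 where "E1 = {e \<in> G. fst (fst e) \<in> {1..int n}}"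
  define E2 where "E2 = {e \<in> G. fst (snd e) \<in> {1..int n}}"
  have *: "a \<in> R \<and> b \<in> L \<and> fst a < fst b" if "(a, b) \<in> G" for a b
    using pp that by (auto simp: perfect_pairing_def)
  have inj1: "b = b'" if "(a, b) \<in> G" "(a, b') \<in> G" for a b b'
    using pp that *[of a b] unfolding perfect_pairing_def by blast
  have inj2: "a = a'" if "(a, b) \<in> G" "(a', b) \<in> G" for a a' b
    using pp that *[of a b] unfolding perfect_pairing_def by blast
  have ex1: "\<exists>b. (a, b) \<in> G" if "a \<in> R" for a
    using pp that unfolding perfect_pairing_def by blast
  have ex2: "\<exists>a. (a, b) \<in> G" if "b \<in> L" for b
    using pp that unfolding perfect_pairing_def by blast
  have i1: "inj_on fst E1"
    using inj1 by (auto simp: inj_on_def E1_def)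
  have im1: "fst ` E1 = {s \<in> R. fst s \<in> {1..int n}}"
    using * ex1 by (force simp: E1_def image_iff)
  have i2: "inj_on snd E2"
    using inj2 by (auto simp: inj_on_def E2_def)
  have im2: "snd ` E2 = {s \<in> L. fst s \<in> {1..int n}}"
    using * ex2 by (force simp: E2_def image_iff)
  have f1: "finite E1" and f2: "finite E2"
    using finite_imageD[OF _ i1] finite_imageD[OF _ i2] finR finL unfolding im1 im2 by blast+
  have c1: "card E1 = card {s \<in> R. fst s \<in> {1..int n}}"
    using card_image[OF i1] im1 by simp
  have c2: "card E2 = card {s \<in> L. fst s \<in> {1..int n}}"
    using card_image[OF i2] im2 by simp
  have fl: "finite (long_edges G i k)" for i k
    using fin by (simp add: long_edges_def)
  have "E1 - E2 \<subseteq> (\<Union>k\<in>{1..n}. long_edges G (int n + 1 - int k) k)"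
  proof
    fix e assume e: "e \<in> E1 - E2"
    obtain a b where ab: "e = (a, b)" by (cases e)
    have G: "(a, b) \<in> G" and a: "1 \<le> fst a" "fst a \<le> int n" and b: "\<not> (1 \<le> fst b \<and> fst b \<le> int n)"
      using e ab by (auto simp: E1_def E2_def)
    have "fst a < fst b" using *[OF G] by simp
    \<comment> \<open>The index is the distance from the inner end to \<open>n + 1\<close>, the
      first vertex beyond the window; the other end lies there or further right.\<close>
    then have "e \<in> long_edges G (int n + 1 - int (nat (int n + 1 - fst a))) (nat (int n + 1 - fst a))"
      using G a b ab by (auto simp: long_edges_def edges_at_def edge_length_def)
    moreover have "nat (int n + 1 - fst a) \<in> {1..n}" using a by auto
    ultimately show "e \<in> (\<Union>k\<in>{1..n}. long_edges G (int n + 1 - int k) k)" by blast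
  qed
  then have d1: "card (E1 - E2) \<le> (\<Sum>k=1..n. card (long_edges G (int n + 1 - int k) k))"
    by (intro order_trans[OF card_mono card_UN_le]) (auto simp: fl)
  have "E2 - E1 \<subseteq> (\<Union>k\<in>{1..n}. long_edges G (int k) k)"
  proof
    fix e assume e: "e \<in> E2 - E1"
    obtain a b where ab: "e = (a, b)" by (cases e)
    have G: "(a, b) \<in> G" and b: "1 \<le> fst b" "fst b \<le> int n" and a: "\<not> (1 \<le> fst a \<and> fst a \<le> int n)"
      using e ab by (auto simp: E1_def E2_def)
    have "fst a < fst b" using *[OF G] by simp
    \<comment> \<open>Here the outer end lies at 0 or further left, so the length is at least
      \<open>fst b\<close>.\<close>
    then have "e \<in> long_edges G (int (nat (fst b))) (nat (fst b))"
      using G a b ab by (auto simp: long_edges_def edges_at_def edge_length_def)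
    moreover have "nat (fst b) \<in> {1..n}" using b by auto
    ultimately show "e \<in> (\<Union>k\<in>{1..n}. long_edges G (int k) k)" by blast
  qed
  then have d2: "card (E2 - E1) \<le> (\<Sum>k=1..n. card (long_edges G (int k) k))"
    by (intro order_trans[OF card_mono card_UN_le]) (auto simp: fl)
  have "card E1 = card (E1 \<inter> E2) + card (E1 - E2)" "card E2 = card (E1 \<inter> E2) + card (E2 - E1)"
    using card_Int_Diff[OF f1, of E2] card_Int_Diff[OF f2, of E1] by (simp_all add: Int_commute)
  then show ?thesis
    using d1 d2 c1 c2 by (simp add: sum.distrib del: of_nat_sum)
qed

text \<open>Stationarity speaks about the number of edges of each exact length; splitting by length
  reduces tail counts to these. The series runs over all lengths, as the set of lengths that occur
  varies with the outcome.\<close>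

lemma card_filter_eq_suminf:
  fixes f :: "'a \<Rightarrow> nat"
  assumes "finite E"
  shows "(of_nat (card {e \<in> E. P (f e)}) :: ennreal) =
    (\<Sum>l. if P l then of_nat (card {e \<in> E. f e = l}) else 0)"
proof -
  have "card {e \<in> E. P (f e)} = (\<Sum>l\<in>f ` E. card {e \<in> {e \<in> E. P (f e)}. f e = l})"
    using assms sum.group[of "{e \<in> E. P (f e)}" "f ` E" f "\<lambda>_. 1 :: nat"]
    by (simp add: image_mono Collect_mono_iff)
  also have "\<dots> = (\<Sum>l\<in>f ` E. if P l then card {e \<in> E. f e = l} else 0)"
    by (intro sum.cong refl) (auto intro!: arg_cong[of _ _ card] simp: card_eq_0_iff)
  finally have "(of_nat (card {e \<in> E. P (f e)}) :: ennreal) =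
      (\<Sum>l\<in>f ` E. if P l then of_nat (card {e \<in> E. f e = l}) else 0)"
    by (simp add: of_nat_sum if_distrib cong: if_cong)
  also have "\<dots> = (\<Sum>l. if P l then of_nat (card {e \<in> E. f e = l}) else 0)"
    using assms by (intro suminf_finite[symmetric]) (auto intro!: card_eq_0_iff[THEN iffD2] simp: image_iff)
  finally show ?thesis .
qed

text \<open>Double counting: an edge of length \<open>l\<close> is counted once for each
  \<open>k\<close> in \<open>{1..n}\<close> with \<open>k \<le> l\<close>, hence at most
  \<open>l\<close> times.\<close>

lemma sum_card_long_edges_le_total_length:
  assumes fin: "finite (edges_at G i)"
  shows "(\<Sum>k=1..n. of_nat (card (long_edges G i k))) \<le> total_length G i"
proof -
  have "(\<Sum>k=1..n. card (long_edges G i k)) = (\<Sum>k=1..n. \<Sum>e\<in>edges_at G i. if k \<le> edge_length e then 1 else 0)"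
    using fin by (simp add: long_edges_def sum.If_cases Int_def)
  also have "\<dots> = (\<Sum>e\<in>edges_at G i. card {k \<in> {1..n}. k \<le> edge_length e})"
    by (subst sum.swap) (simp add: sum.If_cases Int_def)
  also have "\<dots> \<le> (\<Sum>e\<in>edges_at G i. edge_length e)"
  proof (rule sum_mono)
    fix e have "card {k \<in> {1..n}. k \<le> edge_length e} \<le> card {1..edge_length e}"
      by (rule card_mono) auto
    then show "card {k \<in> {1..n}. k \<le> edge_length e} \<le> edge_length e" by simp
  qed
  finally have "of_nat (\<Sum>k=1..n. card (long_edges G i k)) \<le> (of_nat (\<Sum>e\<in>edges_at G i. edge_length e) :: ennreal)"
    by (simp only: of_nat_le_iff)
  then show ?thesis
    using fin by (simp add: total_length_def)
qed

lemma total_length_le_card_mult_longest: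
  assumes fin: "finite (edges_at G i)"
  shows "total_length G i \<le> of_nat (card (edges_at G i)) * longest_length G i"
proof -
  have "(\<Sum>e\<in>edges_at G i. of_nat (edge_length e)) \<le> (\<Sum>e\<in>edges_at G i. longest_length G i)"
    unfolding longest_length_def by (intro sum_mono SUP_upper)
  then show ?thesis using fin by (simp add: total_length_def)
qed

section \<open>Measurability and stationarity of edge counts\<close>

lemma measurable_card_countable:
  fixes S :: "'a \<Rightarrow> 'b :: countable set"
  assumes "\<And>e. {x \<in> space M. e \<in> S x} \<in> sets M"
  shows "(\<lambda>x. card (S x)) \<in> measurable M (count_space UNIV)"
proof -
  \<comment> \<open>The injection \<open>to_nat\<close> moves the question to sets of naturals and
    preserves \<open>card\<close>, also for infinite sets, where both sides are 0.\<close>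
  have "(\<lambda>x. card (to_nat ` S x)) \<in> measurable M (count_space UNIV)"
  proof (rule measurable_card)
    fix i :: nat
    have "{x \<in> space M. i \<in> to_nat ` S x} = (\<Union>e\<in>{e. to_nat e = i}. {x \<in> space M. e \<in> S x})"
      by auto
    also have "\<dots> \<in> sets M"
      using assms by (intro sets.countable_UN') auto
    finally show "{x \<in> space M. i \<in> to_nat ` S x} \<in> sets M" .
  qed
  then show ?thesis by (simp add: card_image)
qed

lemma pairing_rule_measurable_card:
  assumes "pairing_rule M D right A"
  shows "(\<lambda>\<omega>. card {e \<in> edges_at (A \<omega>) i. P e}) \<in> measurable M (count_space UNIV)"
proof (rule measurable_card_countable)
  fix e :: edge
  have "{\<omega> \<in> space M. e \<in> {e \<in> edges_at (A \<omega>) i. P e}} =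
      (if (fst (fst e) = i \<or> fst (snd e) = i) \<and> P e then {\<omega> \<in> space M. e \<in> A \<omega>} else {})"
    by (auto simp: edges_at_def)
  moreover have "{\<omega> \<in> space M. e \<in> A \<omega>} \<in> sets M"
    using assms unfolding pairing_rule_def by blast
  ultimately show "{\<omega> \<in> space M. e \<in> {e \<in> edges_at (A \<omega>) i. P e}} \<in> sets M"
    by simp
qed

context rd_algorithm
begin

lemma measurable_D: "D i \<in> measurable M (count_space UNIV)"
  using indep_D by (auto simp: indep_vars_def)

lemma measurable_right: "right s \<in> measurable M (count_space UNIV)"
  using indep_right unfolding indep_vars_def by blast

text \<open>The vertex \<open>i\<close> carries \<open>D i\<close> stubs, so the bounds for all
  \<open>i\<close> hold simultaneously on the single event that the pairing is perfect.\<close>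

lemma AE_pairing:
  assumes "pairing_rule M D right A"
  shows "AE \<omega> in M. perfect_pairing (right_arrows D right \<omega>) (left_arrows D right \<omega>) (A \<omega>)
    \<and> (\<forall>i. finite (edges_at (A \<omega>) i) \<and> card (edges_at (A \<omega>) i) \<le> D i \<omega>)"
proof -
  have "AE \<omega> in M. perfect_pairing (right_arrows D right \<omega>) (left_arrows D right \<omega>) (A \<omega>)"
    using assms by (simp add: pairing_rule_def)
  then show ?thesis
  proof eventually_elim
    case (elim \<omega>)
    let ?R = "right_arrows D right \<omega>" and ?L = "left_arrows D right \<omega>"
    have disj: "?R \<inter> ?L = {}" by (auto simp: right_arrows_def left_arrows_def)
    have eq: "{s \<in> ?R \<union> ?L. fst s = i} = {i} \<times> {..<D i \<omega>}" for i
      by (auto simp: right_arrows_def left_arrows_def)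
    show ?case
      using perfect_pairing_finite_edges_at[OF elim disj, unfolded eq] elim by simp
  qed
qed

text \<open>Equality of laws gives equal expected counts for each exact length; summing these over
  all lengths from \<open>k\<close> on gives the tail counts.\<close>

lemma stationary_long_edges:
  assumes A: "pairing_rule M D right A" and st: "stationary_rule M A"
  shows "(\<integral>\<^sup>+ \<omega>. of_nat (card (long_edges (A \<omega>) i k)) \<partial>M) = (\<integral>\<^sup>+ \<omega>. of_nat (card (long_edges (A \<omega>) 0 k)) \<partial>M)"
proof -
  let ?P = "Pi\<^sub>M UNIV (\<lambda>_ :: int \<times> nat. count_space (UNIV :: nat set))"
  note [measurable] = pairing_rule_measurable_card[OF A]
  have elc[measurable]: "(\<lambda>\<omega>. edge_length_count (A \<omega>) i l) \<in> measurable M (count_space UNIV)" for i l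
    unfolding edge_length_count_def by measurable
  have elc'[measurable]: "(\<lambda>\<omega>. of_nat (edge_length_count (A \<omega>) i l) :: ennreal) \<in> borel_measurable M" for i l
    by (rule measurable_compose[OF elc]) simp
  have field[measurable]: "(\<lambda>\<omega> (i, l). edge_length_count (A \<omega>) (i + k) l) \<in> measurable M ?P" for k
    by (rule measurable_PiM_single') (auto simp: split_beta)
  have comp[measurable]: "(\<lambda>f. of_nat (f (0, l)) :: ennreal) \<in> borel_measurable ?P" for l
    by (rule measurable_compose[OF measurable_component_singleton]) auto
  \<comment> \<open>The count at \<open>i\<close> is the coordinate \<open>(0, l)\<close> of the
    field shifted by \<open>i\<close>, so its expectation depends only on the law of that
    field.\<close>
  have shift: "(\<integral>\<^sup>+ \<omega>. of_nat (edge_length_count (A \<omega>) i l) \<partial>M) =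
      (\<integral>\<^sup>+ f. of_nat (f (0, l)) \<partial>distr M ?P (\<lambda>\<omega> (j, l). edge_length_count (A \<omega>) (j + i) l))" for i l
    by (subst nn_integral_distr) auto
  have "(\<integral>\<^sup>+ \<omega>. of_nat (edge_length_count (A \<omega>) i l) \<partial>M) = (\<integral>\<^sup>+ \<omega>. of_nat (edge_length_count (A \<omega>) 0 l) \<partial>M)" for l
    using st unfolding shift stationary_rule_def by simp
  then have "(\<integral>\<^sup>+ \<omega>. (if k \<le> l then of_nat (edge_length_count (A \<omega>) i l) else 0) \<partial>M) =
      (\<integral>\<^sup>+ \<omega>. (if k \<le> l then of_nat (edge_length_count (A \<omega>) 0 l) else 0) \<partial>M)" for l
    by (cases "k \<le> l") auto
  then have "(\<Sum>l. \<integral>\<^sup>+ \<omega>. (if k \<le> l then of_nat (edge_length_count (A \<omega>) i l) else 0) \<partial>M) =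
      (\<Sum>l. \<integral>\<^sup>+ \<omega>. (if k \<le> l then of_nat (edge_length_count (A \<omega>) 0 l) else 0) \<partial>M)"
    by (rule suminf_cong)
  moreover have "(\<integral>\<^sup>+ \<omega>. of_nat (card (long_edges (A \<omega>) i k)) \<partial>M) =
      (\<Sum>l. \<integral>\<^sup>+ \<omega>. (if k \<le> l then of_nat (edge_length_count (A \<omega>) i l) else 0) \<partial>M)" for i
  proof (subst nn_integral_suminf[symmetric])
    show "(\<integral>\<^sup>+ \<omega>. of_nat (card (long_edges (A \<omega>) i k)) \<partial>M) =
      (\<integral>\<^sup>+ \<omega>. (\<Sum>l. if k \<le> l then of_nat (edge_length_count (A \<omega>) i l) else 0) \<partial>M)"
      by (rule nn_integral_cong_AE, use AE_pairing[OF A] in eventually_elim)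
        (simp add: long_edges_def edge_length_count_def card_filter_eq_suminf cong: if_cong)
  qed measurable
  ultimately show ?thesis by simp
qed

section \<open>The imbalance of a window and its first absolute moment\<close>

text \<open>This is \<open>S\<^sub>n\<close>, written as a sum of signs over the stubs in the window
  so that the exponential turns it into a product.\<close>

definition imbalance :: "nat \<Rightarrow> 'w \<Rightarrow> real" where
  "imbalance n \<omega> = (\<Sum>s\<in>Sigma {1..int n} (\<lambda>i. {..<D i \<omega>}). if right s \<omega> then 1 else -1)"

text \<open>The point is that the bound is free of \<open>n\<close>: vertices at distance
  \<open>k\<close> from the outside contribute only edges of length at least \<open>k\<close>, and
  these tails sum to at most the total length.\<close>

lemma nn_integral_imbalance_le:
  assumes A: "pairing_rule M D right A" and st: "stationary_rule M A"
  shows "(\<integral>\<^sup>+ \<omega>. ennreal \<bar>imbalance n \<omega>\<bar> \<partial>M) \<le> 2 * (\<integral>\<^sup>+ \<omega>. total_length (A \<omega>) 0 \<partial>M)"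
proof -
  let ?c = "\<lambda>i k \<omega>. of_nat (card (long_edges (A \<omega>) i k)) :: ennreal"
  have [measurable]: "?c i k \<in> borel_measurable M" for i k
    unfolding long_edges_def using pairing_rule_measurable_card[OF A]
    by (rule measurable_compose) auto
  have "(\<integral>\<^sup>+ \<omega>. ennreal \<bar>imbalance n \<omega>\<bar> \<partial>M) \<le>
      (\<integral>\<^sup>+ \<omega>. (\<Sum>k=1..n. ?c (int n + 1 - int k) k \<omega> + ?c (int k) k \<omega>) \<partial>M)"
  proof (rule nn_integral_mono_AE, use AE_pairing[OF A] in eventually_elim)
    case (elim \<omega>)
    let ?W = "Sigma {1..int n} (\<lambda>i. {..<D i \<omega>})"
    have R: "{s \<in> right_arrows D right \<omega>. fst s \<in> {1..int n}} = {s \<in> ?W. right s \<omega>}"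
      by (auto simp: right_arrows_def)
    have L: "{s \<in> left_arrows D right \<omega>. fst s \<in> {1..int n}} = {s \<in> ?W. \<not> right s \<omega>}"
      by (auto simp: left_arrows_def)
    define m where "m = (\<Sum>k=1..n. card (long_edges (A \<omega>) (int n + 1 - int k) k) + card (long_edges (A \<omega>) (int k) k))"
    have "\<bar>imbalance n \<omega>\<bar> \<le> real m"
      using perfect_pairing_imbalance_le[of _ _ "A \<omega>" n, OF conjunct1[OF elim]] elim
      unfolding R L imbalance_def m_def by (subst sum_signs) auto
    then have "ennreal \<bar>imbalance n \<omega>\<bar> \<le> of_nat m"
      unfolding ennreal_of_nat_eq_real_of_nat by (rule ennreal_leI)
    then show ?case
      by (simp add: m_def)
  qed
  also have "\<dots> = (\<Sum>k=1..n. (\<integral>\<^sup>+ \<omega>. ?c (int n + 1 - int k) k \<omega> \<partial>M) + (\<integral>\<^sup>+ \<omega>. ?c (int k) k \<omega> \<partial>M))"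
    by (subst nn_integral_sum) (auto simp: nn_integral_add)
  \<comment> \<open>Stationarity moves both boundary terms to the origin; the two sides of the
    window give the factor 2.\<close>
  also have "\<dots> = (\<Sum>k=1..n. 2 * (\<integral>\<^sup>+ \<omega>. ?c 0 k \<omega> \<partial>M))"
    by (simp add: stationary_long_edges[OF A st, of "int n + 1 - int k" for k]
        stationary_long_edges[OF A st, of "int k" for k] mult_2)
  also have "\<dots> = 2 * (\<integral>\<^sup>+ \<omega>. (\<Sum>k=1..n. ?c 0 k \<omega>) \<partial>M)"
    by (subst nn_integral_sum) (auto simp: sum_distrib_left)
  also have "\<dots> \<le> 2 * (\<integral>\<^sup>+ \<omega>. total_length (A \<omega>) 0 \<partial>M)"
    by (rule mult_left_mono[OF nn_integral_mono_AE], use AE_pairing[OF A] in eventually_elim)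
      (auto intro: sum_card_long_edges_le_total_length simp del: One_nat_def)
  finally show ?thesis .
qed

lemma measurable_imbalance: "imbalance n \<in> borel_measurable M"
proof -
  note [measurable] = measurable_D measurable_right
  have [measurable]: "(\<lambda>\<omega>. \<Sum>j<D i \<omega>. if right (i, j) \<omega> then 1 else -1 :: real) \<in> borel_measurable M" for i
    \<comment> \<open>The random number of summands is handled by splitting over the countably many
      values of \<open>D i\<close>.\<close>
    by (rule measurable_compose_countable[where g = "D i"]) measurable
  have "imbalance n = (\<lambda>\<omega>. \<Sum>i\<in>{1..int n}. \<Sum>j<D i \<omega>. if right (i, j) \<omega> then 1 else -1)"
    by (simp add: imbalance_def fun_eq_iff sum.Sigma)
  then show ?thesis by simp
qed

section \<open>The characteristic function of the imbalance\<close>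

text \<open>Integrate over the coins with the degrees fixed: every stub contributes the mean of
  \<open>cis t\<close> and \<open>cis (- t)\<close>, which is \<open>cos t\<close>. What remains is
  a product over the independent degrees.\<close>

lemma expectation_cos_imbalance:
  "expectation (\<lambda>\<omega>. cos (t * imbalance n \<omega>)) = (\<integral>d. cos t ^ d \<partial>measure_pmf F) ^ n"
proof -
  define PD where "PD = Pi\<^sub>M UNIV (\<lambda>_ :: int. count_space (UNIV :: nat set))"
  define PR where "PR = Pi\<^sub>M UNIV (\<lambda>_ :: stub. count_space (UNIV :: bool set))"
  define X where "X = (\<lambda>\<omega> i. D i \<omega>)"
  define Y where "Y = (\<lambda>\<omega> s. right s \<omega>)"
  \<comment> \<open>\<open>z\<close> is the factor of a single coin, and \<open>f\<close> is the
    exponential of the imbalance as a function of the degrees \<open>d\<close> and the coins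
    \<open>r\<close>.\<close>
  define z where "z = (\<lambda>b. cis (if b then t else - t))"
  define W where "W = (\<lambda>d :: int \<Rightarrow> nat. Sigma {1..int n} (\<lambda>i. {..<d i}))"
  define f where "f = (\<lambda>(d, r). \<Prod>s\<in>W d. z (r s))"
  have [measurable]: "D i \<in> measurable M (count_space UNIV)" "right s \<in> measurable M (count_space UNIV)" for i s
    by (rule measurable_D measurable_right)+
  have X[measurable]: "X \<in> measurable M PD"
    unfolding X_def PD_def by (rule measurable_PiM_single') auto
  have Y[measurable]: "Y \<in> measurable M PR"
    unfolding Y_def PR_def by (rule measurable_PiM_single') auto
  interpret DX: prob_space "distr M PD X" by (rule prob_space_distr) (rule X)
  interpret DY: prob_space "distr M PR Y" by (rule prob_space_distr) (rule Y)
  interpret DXY: pair_prob_space "distr M PD X" "distr M PR Y" ..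
  \<comment> \<open>Independence of degrees and coins makes their joint law a product, which opens
    the way to Fubini.\<close>
  have joint: "distr M PD X \<Otimes>\<^sub>M distr M PR Y = distr M (PD \<Otimes>\<^sub>M PR) (\<lambda>\<omega>. (X \<omega>, Y \<omega>))"
  proof (rule pair_measure_eqI)
    fix A B assume "A \<in> sets (distr M PD X)" "B \<in> sets (distr M PR Y)"
    then have [measurable]: "A \<in> sets PD" "B \<in> sets PR" by auto
    have "prob ((X -` A \<inter> space M) \<inter> (Y -` B \<inter> space M)) = prob (X -` A \<inter> space M) * prob (Y -` B \<inter> space M)"
      using indep_D_right by (rule indep_setD)
        (auto simp flip: X_def Y_def PD_def PR_def intro!: in_vimage_algebra)
    moreover have "(\<lambda>\<omega>. (X \<omega>, Y \<omega>)) -` (A \<times> B) \<inter> space M = (X -` A \<inter> space M) \<inter> (Y -` B \<inter> space M)"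
      by auto
    ultimately show "emeasure (distr M PD X) A * emeasure (distr M PR Y) B =
        emeasure (distr M (PD \<Otimes>\<^sub>M PR) (\<lambda>\<omega>. (X \<omega>, Y \<omega>))) (A \<times> B)"
      by (simp add: emeasure_distr emeasure_eq_measure ennreal_mult)
  qed (auto intro: DX.sigma_finite_measure_axioms DY.sigma_finite_measure_axioms cong: sets_pair_measure_cong)
  have finW: "finite (W d)" for d by (simp add: W_def)
  have cD[measurable]: "(\<lambda>d. d i) \<in> measurable PD (count_space UNIV)" for i
    unfolding PD_def by (rule measurable_component_singleton) simp
  have cR[measurable]: "(\<lambda>r. r s) \<in> measurable PR (count_space UNIV)" for s
    unfolding PR_def by (rule measurable_component_singleton) simp
  have zm[measurable]: "(\<lambda>r. z (r s)) \<in> borel_measurable PR" for s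
    by (rule measurable_compose[OF cR]) simp
  have [measurable]: "(\<lambda>p. \<Prod>j<fst p i. z (snd p (i, j))) \<in> borel_measurable (PD \<Otimes>\<^sub>M PR)" for i
    by (rule measurable_compose_countable[where g = "\<lambda>p. fst p i"]) measurable
  have "f = (\<lambda>p. \<Prod>i\<in>{1..int n}. \<Prod>j<fst p i. z (snd p (i, j)))"
    by (auto simp: f_def W_def fun_eq_iff prod.Sigma)
  then have f[measurable]: "f \<in> borel_measurable (PD \<Otimes>\<^sub>M PR)"
    by simp
  have norm_f: "norm (f p) = 1" for p
    by (simp add: f_def split_beta prod_norm[symmetric] z_def)
  have int_f: "integrable (distr M PD X \<Otimes>\<^sub>M distr M PR Y) f"
    by (rule DXY.integrable_const_bound[where B = 1]) (auto simp: norm_f)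
  have z: "expectation (\<lambda>\<omega>. z (right s \<omega>)) = cos t" for s
  proof -
    have "expectation (\<lambda>\<omega>. z (right s \<omega>)) = integral\<^sup>L (distr M (count_space UNIV) (right s)) z"
      by (rule integral_distr[symmetric]) auto
    also have "\<dots> = cos t"
      unfolding distr_right
      by (subst integral_measure_pmf[of UNIV]) (auto simp: z_def complex_eq_iff UNIV_bool)
    finally show ?thesis .
  qed
  \<comment> \<open>For fixed \<open>d\<close> the index set \<open>W d\<close> is a fixed finite
    set, so independence of the coins factorizes the integral.\<close>
  have inner: "(\<integral>r. f (d, r) \<partial>distr M PR Y) = cos t ^ card (W d)" for d
  proof -
    have "(\<integral>r. f (d, r) \<partial>distr M PR Y) = expectation (\<lambda>\<omega>. \<Prod>s\<in>W d. z (right s \<omega>))"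
      unfolding f_def prod.case by (subst integral_distr[OF Y]) (auto simp: Y_def)
    also have "\<dots> = (\<Prod>s\<in>W d. expectation (\<lambda>\<omega>. z (right s \<omega>)))"
    proof (rule indep_vars_lebesgue_integral[OF finW])
      show "indep_vars (\<lambda>_. borel) (\<lambda>s \<omega>. z (right s \<omega>)) (W d)"
        by (rule indep_vars_compose2[OF indep_vars_subset[OF indep_right]]) auto
      show "integrable M (\<lambda>\<omega>. z (right s \<omega>))" for s
        by (rule integrable_const_bound[where B = 1])
          (auto simp: z_def intro!: measurable_compose[OF measurable_right])
    qed
    finally show ?thesis by (simp add: z)
  qed
  have cos_D: "expectation (\<lambda>\<omega>. cos t ^ D i \<omega>) = (\<integral>d. cos t ^ d \<partial>measure_pmf F)" for i
    unfolding distr_D[of i, symmetric] by (rule integral_distr[symmetric]) auto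
  have "cis (t * imbalance n \<omega>) = f (X \<omega>, Y \<omega>)" for \<omega>
  proof -
    have "f (X \<omega>, Y \<omega>) = (\<Prod>s\<in>W (X \<omega>). cis (t * (if right s \<omega> then 1 else -1)))"
      unfolding f_def z_def Y_def prod.case by (intro prod.cong refl) auto
    also have "\<dots> = cis (\<Sum>s\<in>W (X \<omega>). t * (if right s \<omega> then 1 else -1))"
      using finW by (simp add: cis_conv_exp exp_sum sum_distrib_left)
    finally show ?thesis
      by (simp add: imbalance_def W_def X_def sum_distrib_left)
  qed
  then have "expectation (\<lambda>\<omega>. cis (t * imbalance n \<omega>)) = integral\<^sup>L (distr M (PD \<Otimes>\<^sub>M PR) (\<lambda>\<omega>. (X \<omega>, Y \<omega>))) f"
    by (simp add: integral_distr)
  also have "\<dots> = (\<integral>d. \<integral>r. f (d, r) \<partial>distr M PR Y \<partial>distr M PD X)"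
    using DXY.integral_fst'[OF int_f] by (simp add: joint)
  also have "\<dots> = (\<integral>d. complex_of_real (\<Prod>i\<in>{1..int n}. cos t ^ d i) \<partial>distr M PD X)"
    by (simp add: inner W_def power_sum)
  also have "\<dots> = complex_of_real (\<integral>d. (\<Prod>i\<in>{1..int n}. cos t ^ d i) \<partial>distr M PD X)"
    by (rule integral_complex_of_real)
  also have "(\<integral>d. (\<Prod>i\<in>{1..int n}. cos t ^ d i) \<partial>distr M PD X) = expectation (\<lambda>\<omega>. \<Prod>i\<in>{1..int n}. cos t ^ D i \<omega>)"
    by (subst integral_distr[OF X]) (auto simp: X_def intro!: borel_measurable_prod measurable_compose[OF cD])
  also have "\<dots> = (\<Prod>i\<in>{1..int n}. expectation (\<lambda>\<omega>. cos t ^ D i \<omega>))"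
  proof (rule indep_vars_lebesgue_integral)
    show "indep_vars (\<lambda>_. borel) (\<lambda>i \<omega>. cos t ^ D i \<omega>) {1..int n}"
      by (rule indep_vars_compose2[OF indep_vars_subset[OF indep_D]]) auto
    show "integrable M (\<lambda>\<omega>. cos t ^ D i \<omega>)" for i
      by (rule integrable_const_bound[where B = 1])
        (auto simp: power_abs intro!: power_le_one measurable_compose[OF measurable_D])
  qed simp
  finally have "expectation (\<lambda>\<omega>. cis (t * imbalance n \<omega>)) = complex_of_real ((\<integral>d. cos t ^ d \<partial>measure_pmf F) ^ n)"
    by (simp add: cos_D)
  \<comment> \<open>The cosine is recovered as the real part; the value found is already
    real.\<close>
  moreover have "integrable M (\<lambda>\<omega>. cis (t * imbalance n \<omega>))"
    using measurable_imbalance[of n]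
    by (intro integrable_const_bound[where B = 1]) (auto simp: cis_conv_exp)
  then have "Re (expectation (\<lambda>\<omega>. cis (t * imbalance n \<omega>))) = expectation (\<lambda>\<omega>. cos (t * imbalance n \<omega>))"
    by (subst integral_Re[symmetric]) auto
  ultimately show ?thesis by simp
qed

text \<open>One \<open>t\<close>, chosen from \<open>C\<close> alone, keeps the characteristic
  function above 1/2 for all \<open>n\<close>, against its geometric decay in
  \<open>n\<close>.\<close>

lemma imbalance_unbounded:
  assumes F: "F \<noteq> return_pmf 0" and "C < \<infinity>"
    and le: "\<And>n. (\<integral>\<^sup>+ \<omega>. ennreal \<bar>imbalance n \<omega>\<bar> \<partial>M) \<le> C"
  shows False
proof -
  define c where "c = enn2real C"
  have c: "c \<ge> 0" "C = ennreal c" using assms(2) by (auto simp: c_def)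
  \<comment> \<open>This makes \<open>t * c\<close> at most 1/2 and keeps \<open>t\<close> in
    \<open>(0, 1/2]\<close>, so that \<open>cos t\<close> lies in \<open>[0, 1)\<close>; the
    \<open>+ 1\<close> covers \<open>c = 0\<close>.\<close>
  define t where "t = 1 / (2 * (c + 1))"
  have t: "0 < t" "t \<le> 1 / 2" "t * c \<le> 1 / 2" using c by (auto simp: t_def field_simps)
  have cos: "0 \<le> cos t" "cos t < 1"
    using t pi_gt3 cos_monotone_0_pi[of 0 t] by (auto intro!: cos_ge_zero)
  define q where "q = (\<integral>d. cos t ^ d \<partial>measure_pmf F)"
  have int_q: "integrable (measure_pmf F) (\<lambda>d. cos t ^ d)"
    using cos by (intro measure_pmf.integrable_const_bound[where B = 1]) (simp_all add: power_le_one)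
  have "0 \<le> q" unfolding q_def using cos by (intro Bochner_Integration.integral_nonneg) auto
  have one: "1 - q = (\<integral>d. 1 - cos t ^ d \<partial>measure_pmf F)"
    unfolding q_def using int_q by simp
  \<comment> \<open>If \<open>q = 1\<close>, the nonnegative integrand \<open>1 - cos t ^ d\<close>
    vanishes almost surely, which forces \<open>d = 0\<close>. This is where
    \<open>F \<noteq> return_pmf 0\<close> enters.\<close>
  have "q \<noteq> 1"
  proof
    assume "q = 1"
    then have "AE d in measure_pmf F. 1 - cos t ^ d = 0"
      using one int_q cos
      by (subst integral_nonneg_eq_0_iff_AE[symmetric]) (simp_all add: power_le_one)
    moreover have "cos t ^ d < 1" if "d \<noteq> 0" for d
    proof -
      have "cos t ^ d \<le> cos t ^ 1"
        using cos that by (intro power_decreasing) auto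
      then show ?thesis using cos by simp
    qed
    ultimately have "set_pmf F \<subseteq> {0}"
      by (force simp: AE_measure_pmf_iff)
    with F show False by (simp add: set_pmf_subset_singleton)
  qed
  moreover have "0 \<le> 1 - q"
    unfolding one using cos by (intro Bochner_Integration.integral_nonneg) (auto intro: power_le_one)
  ultimately have "q < 1" by simp
  have half: "1 / 2 \<le> q ^ n" for n
  proof -
    have im: "integrable M (\<lambda>\<omega>. \<bar>imbalance n \<omega>\<bar>)"
      using measurable_imbalance[of n] le_less_trans[OF le[of n] assms(2)]
      by (intro integrableI_bounded) auto
    have "ennreal (expectation (\<lambda>\<omega>. \<bar>imbalance n \<omega>\<bar>)) \<le> ennreal c"
      using le[of n] c nn_integral_eq_integral[OF im] by simp
    then have e: "expectation (\<lambda>\<omega>. \<bar>imbalance n \<omega>\<bar>) \<le> c"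
      using c by simp
    have ic: "integrable M (\<lambda>\<omega>. cos (t * imbalance n \<omega>))"
      using measurable_imbalance[of n] by (intro integrable_const_bound[where B = 1]) auto
    \<comment> \<open>A bound linear in \<open>x\<close> is wanted, as only the first absolute
      moment is controlled: of the two sine factors one is bounded by
      \<open>\<bar>x / 2\<bar>\<close>, the other by 1.\<close>
    have cos_ge: "1 - cos x \<le> \<bar>x\<bar>" for x :: real
    proof -
      have "1 - cos x = 2 * (\<bar>sin (x / 2)\<bar> * \<bar>sin (x / 2)\<bar>)"
        using cos_double_sin[of "x / 2"] by (simp add: power2_eq_square)
      also have "\<dots> \<le> 2 * (\<bar>x / 2\<bar> * 1)"
        by (intro mult_left_mono mult_mono abs_sin_x_le_abs_x) auto
      finally show ?thesis by simp
    qed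
    have "1 - q ^ n = expectation (\<lambda>\<omega>. 1 - cos (t * imbalance n \<omega>))"
      using ic by (simp add: expectation_cos_imbalance q_def prob_space)
    also have "\<dots> \<le> expectation (\<lambda>\<omega>. t * \<bar>imbalance n \<omega>\<bar>)"
    proof (rule integral_mono)
      show "1 - cos (t * imbalance n \<omega>) \<le> t * \<bar>imbalance n \<omega>\<bar>" for \<omega>
        using cos_ge[of "t * imbalance n \<omega>"] t by (simp add: abs_mult)
    qed (use ic im in auto)
    also have "\<dots> \<le> t * c"
      using e t by simp
    finally show ?thesis using t by simp
  qed
  obtain n where "q ^ n < 1 / 2"
    using real_arch_pow_inv[of "1 / 2" q] \<open>q < 1\<close> by auto
  with half[of n] show False by simp
qed

section \<open>Infinite expectation of the total and the longest length\<close>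

lemma nn_integral_total_length:
  assumes "F \<noteq> return_pmf 0" "pairing_rule M D right A" "stationary_rule M A"
  shows "(\<integral>\<^sup>+ \<omega>. total_length (A \<omega>) 0 \<partial>M) = \<infinity>"
proof (rule ccontr)
  assume "(\<integral>\<^sup>+ \<omega>. total_length (A \<omega>) 0 \<partial>M) \<noteq> \<infinity>"
  then have "2 * (\<integral>\<^sup>+ \<omega>. total_length (A \<omega>) 0 \<partial>M) < \<infinity>"
    by (simp add: ennreal_mult_less_top less_top)
  from imbalance_unbounded[OF assms(1) this nn_integral_imbalance_le[OF assms(2,3)]] show False .
qed

lemma nn_integral_longest_length:
  assumes F: "F \<noteq> return_pmf 0" and bdd: "bdd_above (set_pmf F)"
    and A: "pairing_rule M D right A" "stationary_rule M A"
  shows "(\<integral>\<^sup>+ \<omega>. longest_length (A \<omega>) 0 \<partial>M) = \<infinity>"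
proof (rule ccontr)
  assume fin: "(\<integral>\<^sup>+ \<omega>. longest_length (A \<omega>) 0 \<partial>M) \<noteq> \<infinity>"
  obtain K where K: "\<And>d. d \<in> set_pmf F \<Longrightarrow> d \<le> K"
    using bdd by (auto simp: bdd_above_def)
  \<comment> \<open>The bound on the support of \<open>F\<close> is carried over to
    \<open>D 0\<close> through its law.\<close>
  have "AE d in distr M (count_space UNIV) (D 0). d \<le> K"
    unfolding distr_D using K by (auto simp: AE_measure_pmf_iff)
  then have D: "AE \<omega> in M. D 0 \<omega> \<le> K"
    using measurable_D by (subst (asm) AE_distr_iff) auto
  have T: "AE \<omega> in M. total_length (A \<omega>) 0 \<le> of_nat K * longest_length (A \<omega>) 0"
    using AE_pairing[OF A(1)] D
  proof eventually_elim
    case (elim \<omega>)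
    then have "total_length (A \<omega>) 0 \<le> of_nat (card (edges_at (A \<omega>) 0)) * longest_length (A \<omega>) 0"
      by (intro total_length_le_card_mult_longest) auto
    also have "\<dots> \<le> of_nat K * longest_length (A \<omega>) 0"
      using elim by (intro mult_right_mono) (auto intro: order_trans)
    finally show ?case .
  qed
  have [measurable]: "Measurable.pred M (\<lambda>\<omega>. e \<in> edges_at (A \<omega>) 0)" for e
  proof -
    have [measurable]: "Measurable.pred M (\<lambda>\<omega>. e \<in> A \<omega>)"
      using A(1) unfolding pairing_rule_def pred_def by blast
    have "(\<lambda>\<omega>. e \<in> edges_at (A \<omega>) 0) = (\<lambda>\<omega>. e \<in> A \<omega> \<and> (fst (fst e) = 0 \<or> fst (snd e) = 0))"
      by (auto simp: edges_at_def fun_eq_iff)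
    then show ?thesis by simp
  qed
  \<comment> \<open>For measurability the supremum over a random set becomes one over the countable
    type of all edges; the default 0 is harmless, being the least element of
    \<open>ennreal\<close>.\<close>
  have "longest_length (A \<omega>) 0 = (SUP e. if e \<in> edges_at (A \<omega>) 0 then of_nat (edge_length e) else 0)" for \<omega>
    unfolding longest_length_def
  proof (rule antisym; rule SUP_least)
    fix e assume "e \<in> edges_at (A \<omega>) 0"
    then show "of_nat (edge_length e) \<le> (SUP e. if e \<in> edges_at (A \<omega>) 0 then of_nat (edge_length e) else (0 :: ennreal))"
      by (intro SUP_upper2[of e]) auto
  qed (auto intro: SUP_upper)
  then have [measurable]: "(\<lambda>\<omega>. longest_length (A \<omega>) 0) \<in> borel_measurable M"
    by (simp only:) measurable
  from T have "(\<integral>\<^sup>+ \<omega>. total_length (A \<omega>) 0 \<partial>M) \<le> (\<integral>\<^sup>+ \<omega>. of_nat K * longest_length (A \<omega>) 0 \<partial>M)"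
    by (rule nn_integral_mono_AE)
  also have "\<dots> = of_nat K * (\<integral>\<^sup>+ \<omega>. longest_length (A \<omega>) 0 \<partial>M)"
    by (rule nn_integral_cmult) measurable
  also have "\<dots> < \<infinity>"
    using fin by (simp add: ennreal_mult_less_top less_top of_nat_less_top)
  finally show False
    using nn_integral_total_length[OF F A] by simp
qed

end

theorem theorem5p1:
  fixes M :: "'w measure"
    and F :: "nat pmf"
    and D :: "int \<Rightarrow> 'w \<Rightarrow> nat"
    and right :: "stub \<Rightarrow> 'w \<Rightarrow> bool"
  assumes "rd_algorithm M F D right"
    and "F \<noteq> return_pmf 0"
    and "integrable (measure_pmf F) real"
  shows "(\<forall>A. pairing_rule M D right A \<and> stationary_rule M A \<longrightarrow>
            (\<integral>\<^sup>+ \<omega>. total_length (A \<omega>) 0 \<partial>M) = \<infinity>) \<and>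
         (bdd_above (set_pmf F) \<longrightarrow>
          (\<forall>A. pairing_rule M D right A \<and> stationary_rule M A \<longrightarrow>
            (\<integral>\<^sup>+ \<omega>. longest_length (A \<omega>) 0 \<partial>M) = \<infinity>))"
  using rd_algorithm.nn_integral_total_length[OF assms(1,2)]
    rd_algorithm.nn_integral_longest_length[OF assms(1,2)] by blast

end
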